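(* Let $n,m,p$ be nonnegative integers, and put $$\alpha_j^{(n,m)}=\binom{n}{j}(n+m-j)!,\qquad \beta_j^{(n,m)}=(-1)^j\binom{m}{j}(n+m-j)!,\qquad \gamma_j^{(n,m)}=(-1)^m\frac{n!\,(m+j)!}{(m+n+1+j)!\,j!}.$$ Then the Apostol-type polynomials of consecutive orders $\alpha$ and $\alpha+1$ satisfy the following relations (for each family, for all $\lambda,\alpha$ for which the polynomials are defined, and all $x$). If $0\le p\le m+n$, then $$\sum_{j=0}^{\max(m,n)}\left(\lambda\alpha_j^{(n,m)}-\beta_j^{(n,m)}\right)\frac{\mathcal{B}_{p-j}^{(\alpha+1)}(x;\lambda)}{(p-j)!}=\sum_{j=0}^{m}\beta_j^{(n,m)}\frac{\mathcal{B}_{p-j-1}^{(\alpha)}(x;\lambda)}{(p-j-1)!},$$ $$\sum_{j=0}^{\max(m,n)}\left(\lambda\alpha_j^{(n,m)}+\beta_j^{(n,m)}\right)\frac{\mathcal{E}_{p-j}^{(\alpha+1)}(x;\lambda)}{(p-j)!}=2\sum_{j=0}^{m}\beta_j^{(n,m)}\frac{\mathcal{E}_{p-j}^{(\alpha)}(x;\lambda)}{(p-j)!},$$ $$\sum_{j=0}^{\max(m,n)}\left(\lambda\alpha_j^{(n,m)}+\beta_j^{(n,m)}\right)\frac{\mathcal{G}_{p-j}^{(\alpha+1)}(x;\lambda)}{(p-j)!}=2\sum_{j=0}^{m}\beta_j^{(n,m)}\frac{\mathcal{G}_{p-j-1}^{(\alpha)}(x;\lambda)}{(p-j-1)!}.$$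 If $p\ge m+n+1$, then $$\sum_{j=0}^{\max(m,n)}\left(\lambda\alpha_j^{(n,m)}-\beta_j^{(n,m)}\right)\frac{\mathcal{B}_{p-j}^{(\alpha+1)}(x;\lambda)}{(p-j)!}=\sum_{j=0}^{m}\beta_j^{(n,m)}\frac{\mathcal{B}_{p-j-1}^{(\alpha)}(x;\lambda)}{(p-j-1)!}-\lambda\sum_{j=0}^{p-m-n-1}\gamma_j^{(n,m)}\frac{\mathcal{B}_{p-m-n-j-1}^{(\alpha+1)}(x;\lambda)}{(p-m-n-j-1)!},$$ $$\sum_{j=0}^{\max(m,n)}\left(\lambda\alpha_j^{(n,m)}+\beta_j^{(n,m)}\right)\frac{\mathcal{E}_{p-j}^{(\alpha+1)}(x;\lambda)}{(p-j)!}=2\sum_{j=0}^{m}\beta_j^{(n,m)}\frac{\mathcal{E}_{p-j}^{(\alpha)}(x;\lambda)}{(p-j)!}-\lambda\sum_{j=0}^{p-m-n-1}\gamma_j^{(n,m)}\frac{\mathcal{E}_{p-m-n-j-1}^{(\alpha+1)}(x;\lambda)}{(p-m-n-j-1)!},$$ $$\sum_{j=0}^{\max(m,n)}\left(\lambda\alpha_j^{(n,m)}+\beta_j^{(n,m)}\right)\frac{\mathcal{G}_{p-j}^{(\alpha+1)}(x;\lambda)}{(p-j)!}=2\sum_{j=0}^{m}\beta_j^{(n,m)}\frac{\mathcal{G}_{p-j-1}^{(\alpha)}(x;\lambda)}{(p-j-1)!}-\lambda\sum_{j=0}^{p-m-n-1}\gamma_j^{(n,m)}\frac{\mathcal{G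}_{p-m-n-j-1}^{(\alpha+1)}(x;\lambda)}{(p-m-n-j-1)!}.$$
   Context: The symbols $\alpha_j^{(n,m)}$ are integer coefficients, not to be confused with the order $\alpha$; $\binom{a}{j}=0$ for integers $j>a\ge 0$, so $\alpha_j^{(n,m)}=0$ for $j>n$ and $\beta_j^{(n,m)}=0$ for $j>m$. The Apostol-Bernoulli, Apostol-Euler and Apostol-Genocchi polynomials of order $\alpha$ in the variable $x$ (real or complex) are defined by the generating functions (power series expansions in $t$ around $t=0$) $$\left(\frac{t}{\lambda e^t-1}\right)^{\alpha}e^{xt}=\sum_{k=0}^\infty \mathcal{B}_k^{(\alpha)}(x;\lambda)\frac{t^k}{k!},\qquad \left(\frac{2}{\lambda e^t+1}\right)^{\alpha}e^{xt}=\sum_{k=0}^\infty \mathcal{E}_k^{(\alpha)}(x;\lambda)\frac{t^k}{k!},\qquad \left(\frac{2t}{\lambda e^t+1}\right)^{\alpha}e^{xt}=\sum_{k=0}^\infty \mathcal{G}_k^{(\alpha)}(x;\lambda)\frac{t^k}{k!}.$$ Here $\lambda\in\mathbb{C}$, $1^\alpha:=1$, and the powers are taken with a fixed branch of the logarithm analytic near $t=0$ (the same branch for orders $\alpha$ and $\alpha+1$). The range of parameters is: for $\mathcal{B}$, $\alpha\in\mathbb{C}$ if $\lambda=1$, and $\alpha$ a nonnegative integer if $\lambda\neq 1$; for $\mathcal{E}$, $\alpha\in\mathbb{C}$ and $\lambda\ne -1$; for $\mathcal{G}$, $\alpha\in\mathbb{C}$ if $\lambda=-1$, and $\alpha$ a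 nonnegative integer if $\lambda\ne -1$. Convention: polynomials with negative index are zero, and any term containing such a polynomial (including the accompanying factorial of a negative integer in the denominator) is zero. *)

theory Defs
  imports "HOL-Complex_Analysis.Complex_Analysis"
begin

text \<open>
  The functions whose powers generate the three families. Where numerator and denominator
  both vanish at the origin, the value there is the limit (in HOL, \<open>0 / 0 = 0\<close>).
\<close>

definition bernoulli_base :: "complex \<Rightarrow> complex \<Rightarrow> complex" where
  "bernoulli_base lam t = (if lam = 1 \<and> t = 0 then 1 else t / (lam * exp t - 1))"

definition euler_base :: "complex \<Rightarrow> complex \<Rightarrow> complex" where
  "euler_base lam t = 2 / (lam * exp t + 1)"

definition genocchi_base :: "complex \<Rightarrow> complex \<Rightarrow> complex" where
  "genocchi_base lam t = (if lam = -1 \<and> t = 0 then -2 else 2 * t / (lam * exp t + 1))"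

text \<open>
  \<open>log_branch f L\<close>: \<open>L\<close> is a branch of \<open>log f\<close> analytic near the origin. The
  last conjunct is the convention that powers of 1 are 1.
\<close>

definition log_branch :: "(complex \<Rightarrow> complex) \<Rightarrow> (complex \<Rightarrow> complex) \<Rightarrow> bool" where
  "log_branch f L \<longleftrightarrow>
     L analytic_on {0} \<and> (\<forall>\<^sub>F t in nhds 0. exp (L t) = f t) \<and> (f 0 = 1 \<longrightarrow> L 0 = 0)"

text \<open>
  The power of \<open>f\<close> with exponent \<open>a\<close>. Powers with a nonnegative integer exponent are ordinary
  powers: they need no logarithm, and none exists when \<open>f\<close> vanishes at the origin.
\<close>

definition branch_power ::
  "(complex \<Rightarrow> complex) \<Rightarrow> (complex \<Rightarrow> complex) \<Rightarrow> complex \<Rightarrow> complex \<Rightarrow> complex" where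
  "branch_power f L a t = (if a \<in> \<nat> then f t ^ nat \<lfloor>Re a\<rfloor> else exp (a * L t))"

text \<open>The sequence \<open>P\<^sub>k\<close> with generating function \<open>F t = (\<Sum>k. P\<^sub>k * t ^ k / k!)\<close>.\<close>

definition egf_coeff :: "(complex \<Rightarrow> complex) \<Rightarrow> nat \<Rightarrow> complex" where
  "egf_coeff F k = fact k * fps_nth (fps_expansion F 0) k"

definition apostol_bernoulli ::
  "(complex \<Rightarrow> complex) \<Rightarrow> complex \<Rightarrow> complex \<Rightarrow> nat \<Rightarrow> complex \<Rightarrow> complex" where
  "apostol_bernoulli L a lam k x =
     egf_coeff (\<lambda>t. branch_power (bernoulli_base lam) L a t * exp (x * t)) k"

definition apostol_euler ::
  "(complex \<Rightarrow> complex) \<Rightarrow> complex \<Rightarrow> complex \<Rightarrow> nat \<Rightarrow> complex \<Rightarrow> complex" where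
  "apostol_euler L a lam k x =
     egf_coeff (\<lambda>t. branch_power (euler_base lam) L a t * exp (x * t)) k"

definition apostol_genocchi ::
  "(complex \<Rightarrow> complex) \<Rightarrow> complex \<Rightarrow> complex \<Rightarrow> nat \<Rightarrow> complex \<Rightarrow> complex" where
  "apostol_genocchi L a lam k x =
     egf_coeff (\<lambda>t. branch_power (genocchi_base lam) L a t * exp (x * t)) k"

text \<open>\<open>P\<^sub>i / i!\<close>, where terms with a negative index \<open>i\<close> are zero.\<close>

definition over_fact :: "(nat \<Rightarrow> complex) \<Rightarrow> int \<Rightarrow> complex" where
  "over_fact P i = (if i < 0 then 0 else P (nat i) / fact (nat i))"

text \<open>The truncated subtractions below are only relevant where the binomial coefficient is 0.\<close>

definition alpha_coeff :: "nat \<Rightarrow> nat \<Rightarrow> nat \<Rightarrow> int" where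
  "alpha_coeff n m j = int (n choose j) * fact (n + m - j)"

definition beta_coeff :: "nat \<Rightarrow> nat \<Rightarrow> nat \<Rightarrow> int" where
  "beta_coeff n m j = (-1) ^ j * int (m choose j) * fact (n + m - j)"

definition gamma_coeff :: "nat \<Rightarrow> nat \<Rightarrow> nat \<Rightarrow> complex" where
  "gamma_coeff n m j = (-1) ^ m * (fact n * fact (m + j)) / (fact (m + n + 1 + j) * fact j)"


text \<open>Branches exist, and the generating function identities hold, in the intended ranges.\<close>

lemma log_branch_exists:
  assumes "f analytic_on {0}" "f 0 \<noteq> 0"
  shows "\<exists>L. log_branch f L"
proof -
  define L where "L = (\<lambda>t. Ln (f t / f 0) + Ln (f 0))"
  have "L analytic_on {0}"
    unfolding L_def using assms by (auto intro!: analytic_intros)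
  moreover have "\<forall>\<^sub>F t in nhds 0. f t \<noteq> 0"
    using analytic_at_imp_isCont[OF assms(1)] assms(2)
    by (simp add: isCont_def eventually_nhds_conv_at tendsto_imp_eventually_ne)
  then have "\<forall>\<^sub>F t in nhds 0. exp (L t) = f t"
    by eventually_elim (use assms(2) in \<open>simp add: L_def exp_add\<close>)
  moreover have "f 0 = 1 \<longrightarrow> L 0 = 0" by (simp add: L_def)
  ultimately show ?thesis unfolding log_branch_def by blast
qed

lemma bernoulli_base_analytic: "bernoulli_base lam analytic_on {0}"
proof (cases "lam = 1")
  case True
  define g :: "complex \<Rightarrow> complex" where "g = (\<lambda>t. if t = 0 then 1 else (exp t - 1) / t)"
  have "deriv (\<lambda>t. exp t - 1) 0 = (1::complex)"
    by (rule DERIV_imp_deriv) (auto intro!: derivative_eq_intros)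
  moreover have "(\<lambda>t::complex. exp t - 1) holomorphic_on UNIV"
    by (intro holomorphic_intros)
  ultimately have "g holomorphic_on UNIV"
    using pole_theorem_0[where g = "\<lambda>t. exp t - 1" and a = 0 and f = g and S = UNIV]
    by (simp add: g_def)
  then have "g analytic_on {0}"
    using analytic_on_holomorphic by blast
  then have "(\<lambda>t. inverse (g t)) analytic_on {0}"
    by (rule analytic_on_inverse) (simp add: g_def)
  moreover have "(\<lambda>t. inverse (g t)) = bernoulli_base lam"
    by (auto simp: g_def bernoulli_base_def True fun_eq_iff)
  ultimately show ?thesis by simp
next
  case False
  have "(\<lambda>t. t / (lam * exp t - 1)) analytic_on {0}"
    using False by (auto intro!: analytic_intros)
  then show ?thesis using False by (simp add: bernoulli_base_def[abs_def])
qed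

lemma euler_base_analytic:
  assumes "lam \<noteq> -1"
  shows "euler_base lam analytic_on {0}"
  using assms unfolding euler_base_def[abs_def]
  by (auto intro!: analytic_intros simp: add_eq_0_iff2)

lemma genocchi_base_analytic: "genocchi_base lam analytic_on {0}"
proof -
  have "genocchi_base lam = (\<lambda>t. -2 * bernoulli_base (- lam) t)"
  proof
    fix t
    have D: "- lam * exp t - 1 = - (lam * exp t + 1)" by simp
    have "-2 * (t / (- d)) = 2 * t / d" for d by simp
    then have "-2 * (t / (- lam * exp t - 1)) = 2 * t / (lam * exp t + 1)"
      by (simp only: D)
    moreover have "- lam = 1 \<longleftrightarrow> lam = -1" by (metis minus_minus)
    ultimately show "genocchi_base lam t = -2 * bernoulli_base (- lam) t"
      unfolding genocchi_base_def bernoulli_base_def by auto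
  qed
  moreover have "(\<lambda>t. -2 * bernoulli_base (- lam) t) analytic_on {0}"
    by (intro analytic_intros bernoulli_base_analytic)
  ultimately show ?thesis by simp
qed

lemma branch_power_analytic:
  assumes "f analytic_on {0}" "a \<in> \<nat> \<or> log_branch f L"
  shows "branch_power f L a analytic_on {0}"
  using assms unfolding branch_power_def[abs_def] log_branch_def
  by (cases "a \<in> \<nat>") (auto intro!: analytic_intros)

lemma egf_has_fps_expansion:
  assumes "F analytic_on {0}"
  shows "F has_fps_expansion Abs_fps (\<lambda>k. egf_coeff F k / fact k)"
  using analytic_at_imp_has_fps_expansion_0[OF assms]
  by (simp add: egf_coeff_def fps_nth_inverse)

lemma apostol_bernoulli_egf:
  assumes "a \<in> \<nat> \<or> log_branch (bernoulli_base lam) L"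
  shows "(\<lambda>t. branch_power (bernoulli_base lam) L a t * exp (x * t))
           has_fps_expansion Abs_fps (\<lambda>k. apostol_bernoulli L a lam k x / fact k)"
  unfolding apostol_bernoulli_def using assms
  by (intro egf_has_fps_expansion analytic_intros branch_power_analytic bernoulli_base_analytic)

lemma apostol_euler_egf:
  assumes "lam \<noteq> -1" "a \<in> \<nat> \<or> log_branch (euler_base lam) L"
  shows "(\<lambda>t. branch_power (euler_base lam) L a t * exp (x * t))
           has_fps_expansion Abs_fps (\<lambda>k. apostol_euler L a lam k x / fact k)"
  unfolding apostol_euler_def using assms
  by (intro egf_has_fps_expansion analytic_intros branch_power_analytic euler_base_analytic)

lemma apostol_genocchi_egf:
  assumes "a \<in> \<nat> \<or> log_branch (genocchi_base lam) L"
  shows "(\<lambda>t. branch_power (genocchi_base lam) L a t * exp (x * t))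
           has_fps_expansion Abs_fps (\<lambda>k. apostol_genocchi L a lam k x / fact k)"
  unfolding apostol_genocchi_def using assms
  by (intro egf_has_fps_expansion analytic_intros branch_power_analytic genocchi_base_analytic)

end

theory Submission
  imports Defs
begin

text \<open>
  Let \<open>A\<close>, \<open>B\<close> be the polynomials with coefficients \<open>\<alpha>\<^sub>j\<close>, \<open>\<beta>\<^sub>j\<close>, and \<open>C\<close> the power series with
  coefficients \<open>\<gamma>\<^sub>j\<close>. Up to normalisation, \<open>A / B\<close> is the Pade approximant of the exponential
  function with numerator degree \<open>n\<close> and denominator degree \<open>m\<close>, and \<open>C\<close> describes its error:
  \<open>e\<^sup>t B = A + t\<^bsup>n+m+1\<^esup> C\<close> (lemma \<open>exp_pade\<close>). This is an induction on \<open>m\<close>: each of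
  \<open>A\<close>, \<open>B\<close> and \<open>t\<^bsup>n+m+1\<^esup> C\<close> satisfies the recurrence \<open>U\<^sub>n\<^sub>,\<^sub>m\<^sub>+\<^sub>1 = U\<^sub>n\<^sub>+\<^sub>1\<^sub>,\<^sub>m - t U\<^sub>n\<^sub>,\<^sub>m\<close>,
  for \<open>A\<close> and \<open>B\<close> by Pascal's rule, for \<open>t\<^bsup>n+m+1\<^esup> C\<close> by comparing coefficients.

  On the other hand, if \<open>F\<close> and \<open>G\<close> are the generating functions of orders \<open>a + 1\<close> and \<open>a\<close> of one
  of the three families, then \<open>F\<close> is \<open>G\<close> times the base function, so that
  \<open>(\<lambda> e\<^sup>t + s) F = c t\<^sup>d G\<close> with \<open>(s, c, d)\<close> equal to \<open>(-1, 1, 1)\<close>, \<open>(1, 2, 0)\<close> and \<open>(1, 2, 1)\<close> for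
  Bernoulli, Euler and Genocchi, respectively. Multiplying by \<open>B\<close> and inserting the Pade identity gives
  \<open>(\<lambda> A + s B) F = c t\<^sup>d B G - \<lambda> t\<^bsup>n+m+1\<^esup> C F\<close>, and the coefficients of \<open>t\<^sup>p\<close> on both sides are the
  asserted relations (lemma \<open>egf_relation\<close>); the last term contributes only for \<open>p \<ge> n + m + 1\<close>.
\<close>

unbundle no vec_syntax

section \<open>The Pade identity for the exponential series\<close>

text \<open>
  The numerator and the denominator, in the normalisation \<open>A(0) = B(0) = (n + m)!\<close>.
\<close>

definition pade_num :: "nat \<Rightarrow> nat \<Rightarrow> complex fps" where
  "pade_num n m = Abs_fps (\<lambda>j. of_int (alpha_coeff n m j))"

definition pade_den :: "nat \<Rightarrow> nat \<Rightarrow> complex fps" where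
  "pade_den n m = Abs_fps (\<lambda>j. of_int (beta_coeff n m j))"

text \<open>The error series divided by its leading power \<open>t\<^bsup>n+m+1\<^esup>\<close>.\<close>

definition pade_rem :: "nat \<Rightarrow> nat \<Rightarrow> complex fps" where
  "pade_rem n m = Abs_fps (gamma_coeff n m)"

lemma pade_num_Suc: "pade_num n (Suc m) = pade_num (Suc n) m - fps_X * pade_num n m"
proof (rule fps_ext)
  fix k
  show "pade_num n (Suc m) $ k = (pade_num (Suc n) m - fps_X * pade_num n m) $ k"
    by (cases k) (simp_all add: pade_num_def alpha_coeff_def algebra_simps)
qed

lemma pade_den_Suc: "pade_den n (Suc m) = pade_den (Suc n) m - fps_X * pade_den n m"
proof (rule fps_ext)
  fix k
  show "pade_den n (Suc m) $ k = (pade_den (Suc n) m - fps_X * pade_den n m) $ k"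
    by (cases k) (simp_all add: pade_den_def beta_coeff_def algebra_simps)
qed

lemma pade_rem_Suc: "pade_rem n (Suc m) = pade_rem (Suc n) m - pade_rem n m"
proof -
  have "gamma_coeff n (Suc m) j = gamma_coeff (Suc n) m j - gamma_coeff n m j" for j
  proof -
    define D E M N :: complex
      where "D = fact (m + n + 1 + j)" and "E = fact j" and "M = fact (m + j)" and "N = fact n"
    define K :: complex where "K = of_nat (m + n + 2 + j)"
    have nz: "D \<noteq> 0" "E \<noteq> 0" unfolding D_def E_def by (rule fact_nonzero)+
    have "K \<noteq> 0" unfolding K_def of_nat_eq_0_iff by simp
    have f1: "fact (Suc m + n + 1 + j) = K * D" "fact (m + Suc n + 1 + j) = K * D"
      by (simp_all add: D_def K_def algebra_simps)
    have f2: "fact (Suc m + j) = (of_nat m + of_nat j + 1) * M" "fact (Suc n) = (of_nat n + 1) * N"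
      by (simp_all add: M_def N_def algebra_simps)
    have K: "(of_nat n + 1) - K = - (of_nat m + of_nat j + 1 :: complex)"
      by (simp add: K_def)
    have "gamma_coeff (Suc n) m j - gamma_coeff n m j =
        (-1) ^ m * N * M / (K * D * E) * ((of_nat n + 1) - K)"
      unfolding gamma_coeff_def f1 f2 D_def[symmetric] E_def[symmetric] M_def[symmetric] N_def[symmetric]
      using nz \<open>K \<noteq> 0\<close> by (simp add: field_simps)
    also have "\<dots> = gamma_coeff n (Suc m) j"
      unfolding gamma_coeff_def f1 f2 K E_def[symmetric] N_def[symmetric]
      using nz \<open>K \<noteq> 0\<close> by (simp add: field_simps)
    finally show ?thesis by simp
  qed
  then show ?thesis by (simp add: pade_rem_def fps_eq_iff)
qed

lemma exp_pade:
  "fps_exp 1 * pade_den n m = pade_num n m + fps_X ^ (n + m + 1) * pade_rem n m"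
proof (induction m arbitrary: n)
  case 0
  \<comment> \<open>\<open>A\<close> is \<open>n!\<close> times the Taylor polynomial of degree \<open>n\<close>, and \<open>B = n!\<close>.\<close>
  have B: "pade_den n 0 = fps_const (fact n)"
  proof (rule fps_ext)
    fix k show "pade_den n 0 $ k = fps_const (fact n) $ k"
      by (cases k) (simp_all add: pade_den_def beta_coeff_def)
  qed
  show ?case
  proof (rule fps_ext)
    fix k
    show "(fps_exp 1 * pade_den n 0) $ k =
      (pade_num n 0 + fps_X ^ (n + 0 + 1) * pade_rem n 0) $ k"
    proof (cases "k \<le> n")
      case True
      have "fact n = (of_nat (fact k * fact (n - k) * (n choose k)) :: complex)"
        using binomial_fact_lemma[OF True] by simp
      then show ?thesis using True
        by (simp add: B pade_num_def alpha_coeff_def fps_X_power_mult_nth del: power_Suc)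
    next
      case False
      then obtain i where k: "k = n + 1 + i"
        using less_imp_Suc_add[of n k] by auto
      show ?thesis
        by (simp add: B k pade_num_def pade_rem_def alpha_coeff_def gamma_coeff_def
              fps_X_power_mult_nth binomial_eq_0 del: power_Suc fact_Suc)
    qed
  qed
next
  case (Suc m)
  have "fps_exp 1 * pade_den n (Suc m) =
      fps_exp 1 * pade_den (Suc n) m - fps_X * (fps_exp 1 * pade_den n m)"
    by (simp add: pade_den_Suc algebra_simps)
  also have "\<dots> = pade_num n (Suc m) + fps_X ^ (n + m + 1) *
      (fps_X * (pade_rem (Suc n) m - pade_rem n m))"
    unfolding Suc.IH pade_num_Suc by (simp add: algebra_simps)
  also have "\<dots> = pade_num n (Suc m) + fps_X ^ (n + Suc m + 1) * pade_rem n (Suc m)"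
    unfolding pade_rem_Suc[symmetric] by (simp add: algebra_simps)
  finally show ?case .
qed

section \<open>Relations from the functional equation of the generating functions\<close>

text \<open>
  The summation bound is the degree of the first factor and not \<open>p\<close>; terms with \<open>j > p\<close> vanish by the
  convention on negative indices.
\<close>

lemma fps_mult_egf_nth:
  assumes "\<And>j. j > N \<Longrightarrow> c j = 0"
  shows "(Abs_fps c * Abs_fps (\<lambda>k. P k / fact k)) $ p =
    (\<Sum>j = 0..N. c j * over_fact P (int p - int j))"
  unfolding fps_mult_nth fps_nth_Abs_fps
  by (rule sum.mono_neutral_cong)
     (auto simp: assms over_fact_def nat_diff_distrib' simp flip: of_nat_diff)

lemma egf_relation:
  fixes P Q :: "nat \<Rightarrow> complex"
  assumes "(fps_const lam * fps_exp 1 + fps_const s) * Abs_fps (\<lambda>k. P k / fact k) =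
    fps_const c * fps_X ^ d * Abs_fps (\<lambda>k. Q k / fact k)"
  shows "(\<Sum>j = 0..max m n. (lam * of_int (alpha_coeff n m j) + s * of_int (beta_coeff n m j)) *
            over_fact P (int p - int j)) =
         c * (\<Sum>j = 0..m. of_int (beta_coeff n m j) * over_fact Q (int p - int j - int d)) -
         lam * (if p \<le> m + n then 0 else
           \<Sum>j = 0..p - m - n - 1. gamma_coeff n m j *
              over_fact P (int p - int m - int n - int j - 1))"
proof -
  define F G where "F = Abs_fps (\<lambda>k. P k / fact k)" and "G = Abs_fps (\<lambda>k. Q k / fact k)"
  have "(fps_const lam * pade_num n m + fps_const s * pade_den n m) * F =
      pade_den n m * ((fps_const lam * fps_exp 1 + fps_const s) * F) -
      fps_const lam * (fps_exp 1 * pade_den n m - pade_num n m) * F"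
    by (simp add: algebra_simps)
  also have "\<dots> = fps_const c * (fps_X ^ d * (pade_den n m * G)) -
      fps_const lam * (fps_X ^ (n + m + 1) * (pade_rem n m * F))"
    using assms unfolding exp_pade by (simp add: F_def G_def algebra_simps)
  finally have eq: "(fps_const lam * pade_num n m + fps_const s * pade_den n m) * F = \<dots>" .
  have "fps_const lam * pade_num n m + fps_const s * pade_den n m =
      Abs_fps (\<lambda>j. lam * of_int (alpha_coeff n m j) + s * of_int (beta_coeff n m j))"
    by (simp add: fps_eq_iff pade_num_def pade_den_def)
  then have l: "((fps_const lam * pade_num n m + fps_const s * pade_den n m) * F) $ p =
      (\<Sum>j = 0..max m n. (lam * of_int (alpha_coeff n m j) + s * of_int (beta_coeff n m j)) *
            over_fact P (int p - int j))"
    unfolding F_def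
    by (simp only:) (rule fps_mult_egf_nth, simp add: alpha_coeff_def beta_coeff_def binomial_eq_0)
  have den: "(pade_den n m * G) $ q =
      (\<Sum>j = 0..m. of_int (beta_coeff n m j) * over_fact Q (int q - int j))" for q
    unfolding pade_den_def G_def by (rule fps_mult_egf_nth) (simp add: beta_coeff_def)
  have r1: "(fps_X ^ d * (pade_den n m * G)) $ p =
      (\<Sum>j = 0..m. of_int (beta_coeff n m j) * over_fact Q (int p - int j - int d))"
  proof (cases "p < d")
    case True
    then show ?thesis by (simp add: fps_X_power_mult_nth over_fact_def)
  next
    case False
    then have "int p - int j - int d = int (p - d) - int j" for j by simp
    then show ?thesis using False by (simp only: fps_X_power_mult_nth den if_False)
  qed
  have r2: "(fps_X ^ (n + m + 1) * (pade_rem n m * F)) $ p = (if p \<le> m + n then 0 else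
      \<Sum>j = 0..p - m - n - 1. gamma_coeff n m j *
              over_fact P (int p - int m - int n - int j - 1))"
  proof (cases "p \<le> m + n")
    case True
    then show ?thesis by (simp add: fps_X_power_mult_nth del: power_Suc)
  next
    case False
    then obtain q where q: "p = m + n + 1 + q"
      using less_imp_Suc_add[of "m + n" p] by auto
    have *: "int p - int m - int n - int j - 1 = int q - int j" for j
      by (simp add: q)
    have "(fps_X ^ (n + m + 1) * (pade_rem n m * F)) $ p = (pade_rem n m * F) $ q"
      unfolding fps_X_power_mult_nth by (simp add: q)
    also have "\<dots> = (\<Sum>j = 0..q. gamma_coeff n m j * over_fact P (int q - int j))"
      by (simp add: fps_mult_nth pade_rem_def F_def over_fact_def nat_diff_distrib')
    finally show ?thesis unfolding * by (simp add: q)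
  qed
  show ?thesis using arg_cong[OF eq, of "\<lambda>f. f $ p"]
    by (simp only: l r1 r2 fps_sub_nth fps_mult_left_const_nth)
qed

section \<open>The functional equations of the three families\<close>

lemma Nats_add_1_cases:
  fixes a :: complex
  assumes "a + 1 \<in> \<nat>" "a \<notin> \<nat>"
  shows "a = -1"
proof -
  from assms(1) obtain k where k: "a + 1 = of_nat k" by (rule Nats_cases)
  show ?thesis
  proof (cases k)
    case 0
    then show ?thesis using k by (simp add: add_eq_0_iff2)
  next
    case (Suc i)
    then have "a = of_nat i" using k by (simp add: add.commute)
    then show ?thesis using assms(2) by simp
  qed
qed

text \<open>
  For \<open>a = -1\<close> the two powers are defined differently: order \<open>a + 1 = 0\<close> is an ordinary power, order
  \<open>a\<close> goes through the logarithm. They are related as in all other cases.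
\<close>

lemma branch_power_add_1:
  assumes "a \<notin> \<nat> \<longrightarrow> log_branch f L"
  shows "\<forall>\<^sub>F t in nhds 0. branch_power f L (a + 1) t = f t * branch_power f L a t"
proof (cases "a \<in> \<nat>")
  case True
  then obtain k where a: "a = of_nat k" by (rule Nats_cases)
  have "a + 1 \<in> \<nat>" using True by simp
  moreover have "nat \<lfloor>Re (a + 1)\<rfloor> = Suc k" "nat \<lfloor>Re a\<rfloor> = k" by (simp_all add: a nat_add_distrib)
  ultimately show ?thesis using True by (simp add: branch_power_def)
next
  case False
  then have "\<forall>\<^sub>F t in nhds 0. exp (L t) = f t" using assms by (simp add: log_branch_def)
  then show ?thesis
  proof eventually_elim
    case (elim t)
    show ?case
    proof (cases "a + 1 \<in> \<nat>")
      \<comment> \<open>Here \<open>a = -1\<close>, so the left-hand side is an ordinary power with exponent \<open>0\<close>.\<close>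
      case True
      then show ?thesis using Nats_add_1_cases[OF True False] False
        by (simp add: branch_power_def flip: elim exp_add)
    next
      case F: False
      then show ?thesis using False
        by (simp add: branch_power_def algebra_simps flip: elim exp_add)
    qed
  qed
qed

lemma eventually_exp_affine_nonzero:
  fixes lam s :: complex
  assumes "s \<noteq> 0"
  shows "\<forall>\<^sub>F t in at 0. lam * exp t + s \<noteq> 0"
proof -
  have hol: "(\<lambda>t. lam * exp t + s) holomorphic_on UNIV" by (intro holomorphic_intros)
  \<comment> \<open>Vanishing at both \<open>0\<close> and \<open>1\<close> would force \<open>\<lambda> (e - 1) = 0\<close>, hence \<open>s = 0\<close>.\<close>
  have "\<exists>b. lam * exp b + s \<noteq> 0"
  proof (rule ccontr)
    assume "\<not> ?thesis"
    then have z: "lam * exp b + s = 0" for b by blast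
    have e: "exp 1 \<noteq> (1 :: complex)"
      by (metis exp_of_real exp_eq_one_iff of_real_1 of_real_eq_iff zero_neq_one)
    have "lam * (exp 1 - 1) = (lam * exp 1 + s) - (lam * exp 0 + s)" by (simp add: algebra_simps)
    then have "lam = 0" using e unfolding z by simp
    then show False using z[of 0] assms by simp
  qed
  then obtain b where "lam * exp b + s \<noteq> 0" by blast
  then show ?thesis
    using non_zero_neighbour_alt[OF hol open_UNIV connected_UNIV UNIV_I UNIV_I]
    by (auto elim: eventually_mono)
qed

text \<open>
  The closed form of the base function \<open>f\<close> is needed only where its denominator does not vanish and at
  the origin, because the zeros of the denominator are isolated.
\<close>

lemma egf_functional_equation:
  assumes "a \<notin> \<nat> \<longrightarrow> log_branch f L"
    and F: "(\<lambda>t. branch_power f L (a + 1) t * exp (x * t)) has_fps_expansion F"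
    and G: "(\<lambda>t. branch_power f L a t * exp (x * t)) has_fps_expansion G"
    and f: "\<forall>\<^sub>F t in at 0. lam * exp t + s \<noteq> 0 \<longrightarrow> (lam * exp t + s) * f t = c * t ^ d"
    and f0: "(lam + s) * f 0 = c * 0 ^ d"
    and "s \<noteq> 0"
  shows "(fps_const lam * fps_exp 1 + fps_const s) * F = fps_const c * fps_X ^ d * G"
proof -
  have "\<forall>\<^sub>F t in at 0. (lam * exp t + s) * f t = c * t ^ d"
    using f eventually_exp_affine_nonzero[OF \<open>s \<noteq> 0\<close>, of lam] by eventually_elim simp
  then have "\<forall>\<^sub>F t in nhds 0. (lam * exp t + s) * f t = c * t ^ d"
    using f0 by (simp add: eventually_nhds_conv_at)
  then have eq: "\<forall>\<^sub>F t in nhds 0. (lam * exp t + s) * (branch_power f L (a + 1) t * exp (x * t)) =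
      c * t ^ d * (branch_power f L a t * exp (x * t))"
    using branch_power_add_1[OF assms(1)] by eventually_elim (simp flip: mult.assoc)
  have "(\<lambda>t. (lam * exp t + s) * (branch_power f L (a + 1) t * exp (x * t)))
      has_fps_expansion (fps_const lam * fps_exp 1 + fps_const s) * F"
    by (intro fps_expansion_intros F)
  then have "(\<lambda>t. c * t ^ d * (branch_power f L a t * exp (x * t)))
      has_fps_expansion (fps_const lam * fps_exp 1 + fps_const s) * F"
    using has_fps_expansion_cong[OF eq refl] by blast
  moreover have "(\<lambda>t. c * t ^ d * (branch_power f L a t * exp (x * t)))
      has_fps_expansion fps_const c * fps_X ^ d * G"
    by (intro fps_expansion_intros G)
  ultimately show ?thesis by (rule fps_expansion_unique_complex)
qed

lemma order_add_1_cases: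
  fixes a :: complex
  assumes "a \<notin> \<nat> \<longrightarrow> B"
  shows "a \<in> \<nat> \<or> B" "a + 1 \<in> \<nat> \<or> B"
  using assms by auto

lemma apostol_bernoulli_functional_equation:
  assumes "a \<notin> \<nat> \<longrightarrow> log_branch (bernoulli_base lam) L"
  shows "(fps_const lam * fps_exp 1 + fps_const (-1)) *
      Abs_fps (\<lambda>k. apostol_bernoulli L (a + 1) lam k x / fact k) =
    fps_const 1 * fps_X ^ 1 * Abs_fps (\<lambda>k. apostol_bernoulli L a lam k x / fact k)"
  by (rule egf_functional_equation[OF assms apostol_bernoulli_egf apostol_bernoulli_egf])
     (use order_add_1_cases[OF assms] in
       \<open>auto simp: bernoulli_base_def eventually_at_filter intro!: always_eventually\<close>)

lemma apostol_euler_functional_equation: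
  assumes "lam \<noteq> -1" "a \<notin> \<nat> \<longrightarrow> log_branch (euler_base lam) L"
  shows "(fps_const lam * fps_exp 1 + fps_const 1) *
      Abs_fps (\<lambda>k. apostol_euler L (a + 1) lam k x / fact k) =
    fps_const 2 * fps_X ^ 0 * Abs_fps (\<lambda>k. apostol_euler L a lam k x / fact k)"
  by (rule egf_functional_equation[OF assms(2) apostol_euler_egf apostol_euler_egf])
     (use assms(1) order_add_1_cases[OF assms(2)] in
       \<open>auto simp: euler_base_def eventually_at_filter add_eq_0_iff2 divide_simps
        intro!: always_eventually\<close>)

lemma apostol_genocchi_functional_equation:
  assumes "a \<notin> \<nat> \<longrightarrow> log_branch (genocchi_base lam) L"
  shows "(fps_const lam * fps_exp 1 + fps_const 1) *
      Abs_fps (\<lambda>k. apostol_genocchi L (a + 1) lam k x / fact k) =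
    fps_const 2 * fps_X ^ 1 * Abs_fps (\<lambda>k. apostol_genocchi L a lam k x / fact k)"
  by (rule egf_functional_equation[OF assms apostol_genocchi_egf apostol_genocchi_egf])
     (use order_add_1_cases[OF assms] in
       \<open>auto simp: genocchi_base_def eventually_at_filter intro!: always_eventually\<close>)

section \<open>The relations between consecutive orders\<close>

theorem theorem2:
  fixes n m p :: nat and lam a x :: complex and L :: "complex \<Rightarrow> complex"
  shows
   "((lam = 1 \<or> a \<in> \<nat>) \<and> (a \<notin> \<nat> \<longrightarrow> log_branch (bernoulli_base lam) L) \<longrightarrow>
       (p \<le> m + n \<longrightarrow>
          (\<Sum>j = 0..max m n. (lam * of_int (alpha_coeff n m j) - of_int (beta_coeff n m j)) *
              over_fact (\<lambda>k. apostol_bernoulli L (a + 1) lam k x) (int p - int j))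
          = (\<Sum>j = 0..m. of_int (beta_coeff n m j) *
              over_fact (\<lambda>k. apostol_bernoulli L a lam k x) (int p - int j - 1))) \<and>
       (p \<ge> m + n + 1 \<longrightarrow>
          (\<Sum>j = 0..max m n. (lam * of_int (alpha_coeff n m j) - of_int (beta_coeff n m j)) *
              over_fact (\<lambda>k. apostol_bernoulli L (a + 1) lam k x) (int p - int j))
          = (\<Sum>j = 0..m. of_int (beta_coeff n m j) *
              over_fact (\<lambda>k. apostol_bernoulli L a lam k x) (int p - int j - 1))
            - lam * (\<Sum>j = 0..p - m - n - 1. gamma_coeff n m j *
              over_fact (\<lambda>k. apostol_bernoulli L (a + 1) lam k x) (int p - int m - int n - int j - 1)))) \<and>
    ((lam \<noteq> -1) \<and> (a \<notin> \<nat> \<longrightarrow> log_branch (euler_base lam) L) \<longrightarrow>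
       (p \<le> m + n \<longrightarrow>
          (\<Sum>j = 0..max m n. (lam * of_int (alpha_coeff n m j) + of_int (beta_coeff n m j)) *
              over_fact (\<lambda>k. apostol_euler L (a + 1) lam k x) (int p - int j))
          = 2 * (\<Sum>j = 0..m. of_int (beta_coeff n m j) *
              over_fact (\<lambda>k. apostol_euler L a lam k x) (int p - int j))) \<and>
       (p \<ge> m + n + 1 \<longrightarrow>
          (\<Sum>j = 0..max m n. (lam * of_int (alpha_coeff n m j) + of_int (beta_coeff n m j)) *
              over_fact (\<lambda>k. apostol_euler L (a + 1) lam k x) (int p - int j))
          = 2 * (\<Sum>j = 0..m. of_int (beta_coeff n m j) *
              over_fact (\<lambda>k. apostol_euler L a lam k x) (int p - int j))
            - lam * (\<Sum>j = 0..p - m - n - 1. gamma_coeff n m j *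
              over_fact (\<lambda>k. apostol_euler L (a + 1) lam k x) (int p - int m - int n - int j - 1)))) \<and>
    ((lam = -1 \<or> a \<in> \<nat>) \<and> (a \<notin> \<nat> \<longrightarrow> log_branch (genocchi_base lam) L) \<longrightarrow>
       (p \<le> m + n \<longrightarrow>
          (\<Sum>j = 0..max m n. (lam * of_int (alpha_coeff n m j) + of_int (beta_coeff n m j)) *
              over_fact (\<lambda>k. apostol_genocchi L (a + 1) lam k x) (int p - int j))
          = 2 * (\<Sum>j = 0..m. of_int (beta_coeff n m j) *
              over_fact (\<lambda>k. apostol_genocchi L a lam k x) (int p - int j - 1))) \<and>
       (p \<ge> m + n + 1 \<longrightarrow>
          (\<Sum>j = 0..max m n. (lam * of_int (alpha_coeff n m j) + of_int (beta_coeff n m j)) *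
              over_fact (\<lambda>k. apostol_genocchi L (a + 1) lam k x) (int p - int j))
          = 2 * (\<Sum>j = 0..m. of_int (beta_coeff n m j) *
              over_fact (\<lambda>k. apostol_genocchi L a lam k x) (int p - int j - 1))
            - lam * (\<Sum>j = 0..p - m - n - 1. gamma_coeff n m j *
              over_fact (\<lambda>k. apostol_genocchi L (a + 1) lam k x) (int p - int m - int n - int j - 1))))"
proof (intro conjI impI, goal_cases)
  case 1
  then have "a \<notin> \<nat> \<longrightarrow> log_branch (bernoulli_base lam) L" by blast
  from egf_relation[OF apostol_bernoulli_functional_equation[OF this], where n = n and m = m and p = p]
  show ?case using 1 by simp
next
  case 2
  then have "a \<notin> \<nat> \<longrightarrow> log_branch (bernoulli_base lam) L" by blast
  from egf_relation[OF apostol_bernoulli_functional_equation[OF this], where n = n and m = m and p = p]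
  show ?case using 2 by simp
next
  case 3
  then have "lam \<noteq> -1" "a \<notin> \<nat> \<longrightarrow> log_branch (euler_base lam) L" by blast+
  from egf_relation[OF apostol_euler_functional_equation[OF this], where n = n and m = m and p = p]
  show ?case using 3 by simp
next
  case 4
  then have "lam \<noteq> -1" "a \<notin> \<nat> \<longrightarrow> log_branch (euler_base lam) L" by blast+
  from egf_relation[OF apostol_euler_functional_equation[OF this], where n = n and m = m and p = p]
  show ?case using 4 by simp
next
  case 5
  then have "a \<notin> \<nat> \<longrightarrow> log_branch (genocchi_base lam) L" by blast
  from egf_relation[OF apostol_genocchi_functional_equation[OF this], where n = n and m = m and p = p]
  show ?case using 5 by simp
next
  case 6
  then have "a \<notin> \<nat> \<longrightarrow> log_branch (genocchi_base lam) L" by blast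
  from egf_relation[OF apostol_genocchi_functional_equation[OF this], where n = n and m = m and p = p]
  show ?case using 6 by simp
qed

end
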